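(* Let $\mathcal{A}$ be a Banach algebra such that $\mathrm{rad}(\mathcal{A})=\mathrm{rann}(\mathcal{A})$ and $\mathcal{A}/\mathrm{rad}(\mathcal{A})$ is commutative, and suppose $\mathcal{A}$ has a right identity. Let $(\delta,d)$ be a generalized derivation of $\mathcal{A}$. Then the following are equivalent: (i) $\delta(\mathcal{A})\subseteq\mathrm{rad}(\mathcal{A})$; (ii) $\delta$ is spectrally infinitesimal; (iii) $\delta=d$.
   Context: $\mathrm{rad}(\mathcal{A})$ is the Jacobson radical and $\mathrm{rann}(\mathcal{A})=\{c\in\mathcal{A}: ac=0\ \forall a\in\mathcal{A}\}$. A derivation is a linear map $d:\mathcal{A}\to\mathcal{A}$ with $d(ab)=d(a)b+ad(b)$. A generalized derivation $(\delta,d)$ is a pair where $d$ is a derivation and $\delta:\mathcal{A}\to\mathcal{A}$ is linear with $\delta(ab)=a\delta(b)+d(a)b$ for all $a,b$. A linear map $T$ is spectrally infinitesimal if $r(T(a))=0$ for all $a\in\mathcal{A}$, $r$ the spectral radius. *)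

theory Defs
  imports "HOL-Analysis.Analysis"
begin

text \<open>Complex Banach algebras (not necessarily unital).  The library only has
real normed algebras, so we add a complex scalar multiplication compatible
with the real one, the norm and the product.\<close>

class scaleC =
  fixes scaleC :: "complex \<Rightarrow> 'a \<Rightarrow> 'a"

class complex_banach_algebra = real_normed_algebra + banach + scaleC +
  assumes scaleC_of_real: "scaleC (complex_of_real r) x = scaleR r x"
    and scaleC_add_right: "scaleC c (x + y) = scaleC c x + scaleC c y"
    and scaleC_add_left: "scaleC (c + c') x = scaleC c x + scaleC c' x"
    and scaleC_scaleC: "scaleC c (scaleC c' x) = scaleC (c * c') x"
    and scaleC_one: "scaleC 1 x = x"
    and norm_scaleC: "norm (scaleC c x) = cmod c * norm x"
    and scaleC_mult_left: "scaleC c (x * y) = scaleC c x * y"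
    and scaleC_mult_right: "scaleC c (x * y) = x * scaleC c y"

definition clinear_map :: "('a::complex_banach_algebra \<Rightarrow> 'a) \<Rightarrow> bool" where
  "clinear_map T \<longleftrightarrow> (\<forall>x y. T (x + y) = T x + T y) \<and> (\<forall>c x. T (scaleC c x) = scaleC c (T x))"

text \<open>Quasi-invertibility (\<open>a\<close> is quasi-invertible iff \<open>1 - a\<close> is invertible in the unitization).\<close>
definition quasi_invertible :: "'a::complex_banach_algebra \<Rightarrow> bool" where
  "quasi_invertible a \<longleftrightarrow> (\<exists>b. a + b - a * b = 0 \<and> a + b - b * a = 0)"

text \<open>Spectrum in a possibly non-unital algebra (i.e. spectrum in the unitization).\<close>
definition spectrum :: "'a::complex_banach_algebra \<Rightarrow> complex set" where
  "spectrum a = insert 0 {z. z \<noteq> 0 \<and> \<not> quasi_invertible (scaleC (inverse z) a)}"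

definition spectral_radius :: "'a::complex_banach_algebra \<Rightarrow> real" where
  "spectral_radius a = Sup (cmod ` spectrum a)"

text \<open>Jacobson radical: \<open>a \<in> rad(A)\<close> iff \<open>1 - y a\<close> is invertible in the unitization
for every \<open>y = \<mu>1 + b\<close>, i.e. \<open>\<mu> a + b a\<close> is quasi-invertible.\<close>
definition jacobson_radical :: "'a::complex_banach_algebra set" where
  "jacobson_radical = {a. \<forall>b \<mu>. quasi_invertible (scaleC \<mu> a + b * a)}"

definition right_annihilator :: "'a::complex_banach_algebra set" where
  "right_annihilator = {c. \<forall>a. a * c = 0}"

definition derivation :: "('a::complex_banach_algebra \<Rightarrow> 'a) \<Rightarrow> bool" where
  "derivation d \<longleftrightarrow> clinear_map d \<and> (\<forall>a b. d (a * b) = d a * b + a * d b)"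

definition generalized_derivation :: "('a::complex_banach_algebra \<Rightarrow> 'a) \<Rightarrow> ('a \<Rightarrow> 'a) \<Rightarrow> bool" where
  "generalized_derivation \<delta> d \<longleftrightarrow> derivation d \<and> clinear_map \<delta> \<and>
     (\<forall>a b. \<delta> (a * b) = a * \<delta> b + d a * b)"

definition spectrally_infinitesimal :: "('a::complex_banach_algebra \<Rightarrow> 'a) \<Rightarrow> bool" where
  "spectrally_infinitesimal T \<longleftrightarrow> (\<forall>a. spectral_radius (T a) = 0)"

end

theory Submission
  imports Defs "HOL-Computational_Algebra.Fundamental_Theorem_Algebra"
begin

text \<open>If \<open>e\<close> is a right identity then \<open>\<delta> a = a * \<delta> e + d a\<close>, so everything reduces to
  \<open>d(A) \<subseteq> rad(A)\<close>, which holds without any continuity assumption: \<open>d\<close> preserves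
  \<open>rann(A) = rad(A)\<close> and induces a derivation \<open>D\<close> of the commutative semisimple unital Banach
  algebra \<open>A / rad(A)\<close>, and every such derivation is zero.

  Instead of characters, the proof of the latter uses the separating space of \<open>D\<close>. A gliding hump
  shows that its elements have finite spectrum; by semisimplicity they are roots of polynomials with
  simple zeros and are therefore annihilated by \<open>D\<close>. As the separating space is an ideal, its
  elements then square to zero, hence vanish, and \<open>D\<close> is bounded by the closed graph theorem. The
  commutator of \<open>D\<close> with multiplication by \<open>a\<close> is multiplication by \<open>D a\<close>, so
  the Kleinecke--Shirokov argument makes \<open>D a\<close> quasinilpotent, that is, zero.\<close>

section \<open>Quasinilpotent elements\<close>

definition scal :: "complex \<Rightarrow> 'a::{complex_banach_algebra, comm_ring_1}" where
  "scal z = scaleC z 1"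

lemma scaleC_eq_scal: "scaleC z x = scal z * x"
  by (metis mult_1 scal_def scaleC_mult_left)

lemma scal_add: "scal (z + w) = scal z + scal w"
  by (simp add: scal_def scaleC_add_left)

lemma scal_mult: "scal (z * w) = scal z * scal w"
  by (metis scal_def scaleC_eq_scal scaleC_scaleC)

lemma scal_1 [simp]: "scal 1 = 1"
  by (simp add: scal_def scaleC_one)

lemma scal_0 [simp]: "scal 0 = 0"
  using scal_add[of 0 0] by simp

lemma scal_minus: "scal (- z) = - scal z"
  using scal_add[of "- z" z] by (simp add: eq_neg_iff_add_eq_0)

lemma scal_diff: "scal (z - w) = scal z - scal w"
  using scal_add[of z "- w"] by (simp add: scal_minus)

lemma scal_power: "scal (z ^ n) = scal z ^ n"
  by (induction n) (simp_all add: scal_mult)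

lemma scal_sum: "scal (sum f A) = (\<Sum>x\<in>A. scal (f x))"
  by (induction A rule: infinite_finite_induct) (simp_all add: scal_add)

lemma scal_of_nat: "scal (of_nat n) = of_nat n"
  by (induction n) (simp_all add: scal_add)

lemma scal_inverse: "z \<noteq> 0 \<Longrightarrow> scal z * scal (inverse z) = 1"
  by (simp flip: scal_mult)

lemma scal_dvd_1: "z \<noteq> 0 \<Longrightarrow> scal z dvd 1"
  by (metis dvd_triv_left scal_inverse)

lemma norm_scal_mult: "norm (scal z * x) = cmod z * norm x"
  by (metis norm_scaleC scaleC_eq_scal)

lemma norm_power_le:
  fixes x :: "'a::{complex_banach_algebra, comm_ring_1}"
  shows "norm (x ^ n) \<le> norm (1::'a) * norm x ^ n"
proof (induction n)
  case (Suc n)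
  have "norm (x ^ Suc n) \<le> norm x * norm (x ^ n)"
    by (simp add: norm_mult_ineq)
  also have "\<dots> \<le> norm x * (norm (1::'a) * norm x ^ n)"
    by (intro mult_left_mono Suc) auto
  finally show ?case by (simp add: algebra_simps)
qed simp

lemma one_minus_dvd_1_if_summable:
  fixes x :: "'a::{complex_banach_algebra, comm_ring_1}"
  assumes "summable (\<lambda>n. x ^ n)"
  shows "(1 - x) dvd 1"
proof -
  have "x * (\<Sum>n. x ^ n) = (\<Sum>n. x ^ Suc n)"
    using suminf_mult[OF assms, of x] by simp
  also have "\<dots> = (\<Sum>n. x ^ n) - 1"
    using suminf_split_head[OF assms] by simp
  finally have "(1 - x) * (\<Sum>n. x ^ n) = 1"
    by (simp add: algebra_simps)
  then show ?thesis by (metis dvd_triv_left)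
qed

lemma one_minus_dvd_1_if_norm_less:
  fixes x :: "'a::{complex_banach_algebra, comm_ring_1}"
  assumes "norm x < 1"
  shows "(1 - x) dvd 1"
proof (rule one_minus_dvd_1_if_summable, rule summable_comparison_test')
  show "summable (\<lambda>n. norm (1::'a) * norm x ^ n)"
    using assms by (intro summable_mult summable_geometric) auto
qed (rule norm_power_le)

lemma norm_one_minus_nonunit:
  fixes x :: "'a::{complex_banach_algebra, comm_ring_1}"
  assumes "\<not> x dvd 1"
  shows "norm (1 - x * y) \<ge> 1"
proof (rule ccontr)
  assume "\<not> ?thesis"
  then have "(1 - (1 - x * y)) dvd 1"
    by (intro one_minus_dvd_1_if_norm_less) auto
  then show False using assms by (simp add: dvd_mult_left)
qed

lemma quasi_invertible_iff_dvd_1: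
  fixes x :: "'a::{complex_banach_algebra, comm_ring_1}"
  shows "quasi_invertible x \<longleftrightarrow> (1 - x) dvd 1"
proof
  assume "quasi_invertible x"
  then obtain c where "x + c - x * c = 0" by (auto simp: quasi_invertible_def)
  then have "1 = (1 - x) * (1 - c)" by (simp add: algebra_simps)
  then show "(1 - x) dvd 1" by (metis dvd_triv_left)
next
  assume "(1 - x) dvd 1"
  then obtain y where y: "1 = (1 - x) * y" by (auto elim: dvdE)
  then have "x + (1 - y) - x * (1 - y) = 0" by (simp add: algebra_simps)
  then show "quasi_invertible x" unfolding quasi_invertible_def
    by (metis mult.commute)
qed

lemma sum_roots_of_unity:
  fixes N j :: nat
  assumes "j < N"
  defines "\<omega> \<equiv> cis (2 * pi / real N)"
  shows "(\<Sum>k<N. (\<omega> ^ k) ^ j) = (if j = 0 then of_nat N else 0)"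
proof (cases "j = 0")
  case False
  have N: "N > 0" using assms by simp
  have wN: "\<omega> ^ N = 1" unfolding \<omega>_def by (subst Complex.DeMoivre) (use N in simp)
  have ne: "\<omega> ^ j \<noteq> 1"
  proof
    assume "\<omega> ^ j = 1"
    then have "exp (2 * of_real pi * \<i> * of_nat j / of_nat N) = 1"
      unfolding \<omega>_def Complex.DeMoivre unfolding cis_conv_exp by (simp add: mult_ac)
    then have "N dvd j"
      using N complex_root_unity_eq_1[of N j] by simp
    then show False using False assms by (auto dest: dvd_imp_le)
  qed
  have "(\<Sum>k<N. (\<omega> ^ k) ^ j) = (\<Sum>k<N. (\<omega> ^ j) ^ k)"
    by (simp add: mult.commute flip: power_mult)
  also have "\<dots> = (1 - (\<omega> ^ j) ^ N) / (1 - \<omega> ^ j)"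
    using ne by (simp add: sum_gp_strict)
  also have "(\<omega> ^ j) ^ N = 1" 
    by (metis wN mult.commute power_mult power_one)
  finally show ?thesis using False by simp
qed simp

text \<open>Rickart's argument: averaging the resolvent over the \<open>N\<close>-th roots of unity gives
  \<open>(1 - (t x)^N)\<^sup>-\<^sup>1\<close>, so these inverses are Lipschitz in \<open>t\<close> uniformly in \<open>N\<close>, and
  \<open>(t x)^N \<longlonglongrightarrow> 0\<close> propagates from \<open>t\<close> to \<open>t + h\<close> with a step \<open>h\<close> independent of \<open>t\<close>.\<close>
lemma quasinilpotent_powers_tendsto_0:
  fixes x :: "'a::{complex_banach_algebra, comm_ring_1}"
  assumes inv: "\<And>z. (1 - scal z * x) dvd 1" and "T \<ge> 0"
  shows "(\<lambda>n. T ^ n * norm (x ^ n)) \<longlonglongrightarrow> 0"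
proof -
  obtain R where R: "\<And>z. (1 - scal z * x) * R z = 1"
    using inv unfolding dvd_def by metis
  have res: "R w - R z = scal (w - z) * (x * R w * R z)" for w z
  proof -
    have "R w - R z = R w * ((1 - scal z * x) * R z) - ((1 - scal w * x) * R w) * R z"
      by (simp add: R)
    then show ?thesis by (simp add: algebra_simps scal_diff)
  qed
  have res_norm: "norm (R w - R z) \<le> cmod (w - z) * (norm x * norm (R w) * norm (R z))" for w z
  proof -
    have "norm (R w - R z) = cmod (w - z) * norm (x * R w * R z)"
      by (subst res) (rule norm_scal_mult)
    also have "norm (x * R w * R z) \<le> norm x * norm (R w) * norm (R z)"
      by (meson norm_mult_ineq mult_right_mono norm_ge_zero order_trans)
    finally show ?thesis by (simp add: mult_left_mono)
  qed
  have "isCont R z" for z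
  proof -
    define c where "c = norm x * norm (R z)"
    have c: "c \<ge> 0" by (simp add: c_def)
    have "eventually (\<lambda>w. cmod (w - z) * c \<le> 1 / 2) (at z)"
    proof -
      have "((\<lambda>w. cmod (w - z) * c) \<longlongrightarrow> 0 * c) (at z)"
        by (intro tendsto_mult tendsto_const) (simp add: LIM_zero tendsto_norm_zero)
      from order_tendstoD(2)[OF this, of "1/2"] show ?thesis
        by (auto elim: eventually_mono)
    qed
    then have "eventually (\<lambda>w. norm (R w - R z) \<le> cmod (w - z) * (c * (2 * norm (R z)))) (at z)"
    proof eventually_elim
      case (elim w)
      have 1: "norm (R w - R z) \<le> (cmod (w - z) * c) * norm (R w)"
        using res_norm[of w z] by (simp add: c_def algebra_simps)
      also have "\<dots> \<le> 1 / 2 * norm (R w)"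
        using elim by (intro mult_right_mono) auto
      finally have "norm (R w - R z) \<le> norm (R w) / 2" by simp
      then have "norm (R w) \<le> 2 * norm (R z)"
        using norm_triangle_sub[of "R w" "R z"] by simp
      then have "(cmod (w - z) * c) * norm (R w) \<le> (cmod (w - z) * c) * (2 * norm (R z))"
        using c by (intro mult_left_mono) auto
      with 1 show ?case by (simp add: algebra_simps)
    qed
    moreover have "((\<lambda>w. cmod (w - z) * (c * (2 * norm (R z)))) \<longlongrightarrow> 0) (at z)"
      by (intro tendsto_mult_left_zero) (simp add: LIM_zero tendsto_norm_zero)
    ultimately have "((\<lambda>w. R w - R z) \<longlongrightarrow> 0) (at z)"
      by (rule Lim_null_comparison)
    then show ?thesis by (simp add: isCont_def LIM_zero_iff)
  qed
  then have "compact (R ` cball 0 (T + 1))"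
    by (intro compact_continuous_image continuous_at_imp_continuous_on) auto
  then obtain M where M: "\<And>z. cmod z \<le> T + 1 \<Longrightarrow> norm (R z) \<le> M"
    by (force simp: bounded_iff dest!: compact_imp_bounded)
  have M0: "M \<ge> 0" using order_trans[OF norm_ge_zero M[of 0]] \<open>T \<ge> 0\<close> by simp
  define L where "L = norm x * M * M + 1"
  have L: "L \<ge> 1" using M0 by (simp add: L_def)
  define h where "h = 1 / (4 * L)"
  have h: "0 < h" "h \<le> 1" "L * h = 1 / 4" using L by (auto simp: h_def field_simps)
  define \<omega> where "\<omega> N = cis (2 * pi / real N)" for N :: nat
  define G where "G N t = scal (1 / of_nat N) * (\<Sum>k<N. R (\<omega> N ^ k * complex_of_real t))"
    for N and t :: real
  define y where "y t = scal (complex_of_real t) * x" for t :: real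
  have cmod_w: "cmod (\<omega> N ^ k * complex_of_real t) = \<bar>t\<bar>" for N k t
    by (simp add: \<omega>_def norm_mult norm_power)
  have G_inv: "(1 - y t ^ N) * G N t = 1" if N: "N > 0" for N t
  proof -
    have "(1 - y t ^ N) * R (\<omega> N ^ k * complex_of_real t) = (\<Sum>j<N. scal ((\<omega> N ^ k) ^ j) * y t ^ j)"
      for k
    proof -
      define v where "v = scal (\<omega> N ^ k) * y t"
      have v: "v = scal (\<omega> N ^ k * complex_of_real t) * x"
        by (simp add: v_def y_def scal_mult algebra_simps)
      have "(\<omega> N ^ k) ^ N = (\<omega> N ^ N) ^ k"
        by (simp add: mult.commute flip: power_mult)
      also have "\<omega> N ^ N = 1" unfolding \<omega>_def by (subst Complex.DeMoivre) (use N in simp)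
      finally have "v ^ N = y t ^ N"
        by (simp add: v_def power_mult_distrib flip: scal_power)
      then have "1 - y t ^ N = (1 - v) * (\<Sum>j<N. v ^ j)"
        by (metis one_diff_power_eq)
      then have "(1 - y t ^ N) * R (\<omega> N ^ k * complex_of_real t)
          = ((1 - v) * R (\<omega> N ^ k * complex_of_real t)) * (\<Sum>j<N. v ^ j)"
        by (simp only: mult_ac)
      also have "\<dots> = (\<Sum>j<N. v ^ j)" by (simp add: v R)
      finally show ?thesis by (simp add: v_def power_mult_distrib scal_power)
    qed
    then have "(1 - y t ^ N) * G N t
        = scal (1 / of_nat N) * (\<Sum>k<N. \<Sum>j<N. scal ((\<omega> N ^ k) ^ j) * y t ^ j)"
      by (simp add: G_def sum_distrib_left mult.left_commute)
    also have "(\<Sum>k<N. \<Sum>j<N. scal ((\<omega> N ^ k) ^ j) * y t ^ j)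
        = (\<Sum>j<N. scal (\<Sum>k<N. (\<omega> N ^ k) ^ j) * y t ^ j)"
      by (subst sum.swap) (simp add: scal_sum sum_distrib_right)
    also have "\<dots> = (\<Sum>j<N. if j = 0 then scal (of_nat N) else 0)"
      by (intro sum.cong refl) (simp add: sum_roots_of_unity \<omega>_def)
    also have "\<dots> = scal (of_nat N)" using N by simp
    finally show ?thesis using N by (simp flip: scal_mult)
  qed
  have G_lip: "norm (G N s - G N t) \<le> L * \<bar>s - t\<bar>"
    if N: "N > 0" and st: "0 \<le> s" "s \<le> T + 1" "0 \<le> t" "t \<le> T + 1" for N s t
  proof -
    have *: "norm (R (\<omega> N ^ k * complex_of_real s) - R (\<omega> N ^ k * complex_of_real t)) \<le> L * \<bar>s - t\<bar>"
      (is "norm (R ?s - R ?t) \<le> _") for k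
    proof -
      have "norm (R ?s - R ?t) \<le> cmod (?s - ?t) * (norm x * norm (R ?s) * norm (R ?t))"
        by (rule res_norm)
      also have "?s - ?t = \<omega> N ^ k * complex_of_real (s - t)" by (simp add: algebra_simps)
      also have "cmod \<dots> = \<bar>s - t\<bar>" by (rule cmod_w)
      also have "\<bar>s - t\<bar> * (norm x * norm (R ?s) * norm (R ?t)) \<le> \<bar>s - t\<bar> * (norm x * M * M)"
        using st M0 by (intro mult_left_mono mult_mono M) (auto simp: cmod_w)
      also have "\<dots> \<le> \<bar>s - t\<bar> * L" by (intro mult_left_mono) (auto simp: L_def)
      finally show ?thesis by (simp add: mult.commute)
    qed
    have "G N s - G N t = scal (1 / of_nat N) *
        (\<Sum>k<N. R (\<omega> N ^ k * complex_of_real s) - R (\<omega> N ^ k * complex_of_real t))"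
      by (simp add: G_def sum_subtractf right_diff_distrib)
    then have "norm (G N s - G N t) = 1 / real N *
        norm (\<Sum>k<N. R (\<omega> N ^ k * complex_of_real s) - R (\<omega> N ^ k * complex_of_real t))"
      by (simp add: norm_scal_mult norm_divide)
    also have "\<dots> \<le> 1 / real N * (\<Sum>k<N. L * \<bar>s - t\<bar>)"
      by (intro mult_left_mono sum_norm_le *) auto
    also have "\<dots> = L * \<bar>s - t\<bar>" using N by simp
    finally show ?thesis .
  qed
  have G_bound: "norm (G N t) \<le> M" if N: "N > 0" and t: "0 \<le> t" "t \<le> T + 1" for N t
  proof -
    have "norm (G N t) = 1 / real N * norm (\<Sum>k<N. R (\<omega> N ^ k * complex_of_real t))"
      by (simp add: G_def norm_scal_mult norm_divide)
    also have "\<dots> \<le> 1 / real N * (\<Sum>k<N. M)"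
      using t by (intro mult_left_mono sum_norm_le M) (auto simp: cmod_w)
    finally show ?thesis using N by simp
  qed
  define good where "good t \<longleftrightarrow> (\<lambda>n. y t ^ n) \<longlonglongrightarrow> 0" for t :: real
  have step: "good (t + s)" if t: "0 \<le> t" "t \<le> T" "good t" and s: "0 \<le> s" "s \<le> h / 2" for t s
  proof -
    define u where "u = t + h"
    have u: "0 < u" "u \<le> T + 1" "t + s < u" using t s h by (auto simp: u_def)
    have "(\<lambda>n. norm (y t ^ n) * M) \<longlonglongrightarrow> 0"
      using t(3) unfolding good_def by (intro tendsto_mult_left_zero tendsto_norm_zero)
    from order_tendstoD(2)[OF this, of "1/4"]
    have "eventually (\<lambda>n. norm (y t ^ n) * M < 1 / 4) sequentially" by simp
    then have ev: "eventually (\<lambda>n. norm (y u ^ n) \<le> 3 * norm (1::'a)) sequentially"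
      using eventually_gt_at_top[of 0]
    proof eventually_elim
      case (elim n)
      define H where "H = 1 - y u ^ n"
      have HG: "H * G n u = 1" using G_inv[of n u] elim by (simp add: H_def)
      have "G n t - 1 = y t ^ n * G n t"
        using G_inv[of n t] elim by (simp add: algebra_simps)
      then have "norm (G n t - 1) \<le> norm (y t ^ n) * norm (G n t)"
        by (simp add: norm_mult_ineq)
      also have "\<dots> \<le> norm (y t ^ n) * M"
        using elim t by (intro mult_left_mono G_bound) auto
      finally have 1: "norm (G n t - 1) \<le> 1 / 4" using elim by simp
      have "norm (G n u - G n t) \<le> L * \<bar>u - t\<bar>" using elim t u by (intro G_lip) auto
      then have "norm (G n u - G n t) \<le> 1 / 4" using h by (simp add: u_def)
      with 1 have 2: "norm (1 - G n u) \<le> 1 / 2"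
        using norm_triangle_ineq[of "G n u - G n t" "G n t - 1"] by (simp add: norm_minus_commute)
      have "H = 1 + H * (1 - G n u)" using HG by (simp add: algebra_simps)
      then have "norm H \<le> norm (1::'a) + norm (H * (1 - G n u))"
        by (metis norm_triangle_ineq)
      also have "norm (H * (1 - G n u)) \<le> norm H * norm (1 - G n u)" by (rule norm_mult_ineq)
      also have "\<dots> \<le> norm H * (1 / 2)" using 2 by (intro mult_left_mono) auto
      finally have "norm H \<le> 2 * norm (1::'a)" by simp
      moreover have "norm (y u ^ n) \<le> norm (1::'a) + norm H"
        using norm_triangle_ineq4[of 1 H] by (simp add: H_def)
      ultimately show ?case by simp
    qed
    define q where "q = (t + s) / u"
    have q: "0 \<le> q" "q < 1" using t s u by (auto simp: q_def)
    have "y (t + s) = scal (complex_of_real q) * y u"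
      using u by (simp add: y_def q_def flip: scal_mult mult.assoc)
    then have "norm (y (t + s) ^ n) = q ^ n * norm (y u ^ n)" for n
      using q by (simp add: power_mult_distrib norm_scal_mult norm_power flip: scal_power)
    with ev have "eventually (\<lambda>n. norm (y (t + s) ^ n) \<le> q ^ n * (3 * norm (1::'a))) sequentially"
      using q by (auto elim!: eventually_mono intro!: mult_left_mono)
    moreover have "(\<lambda>n. q ^ n * (3 * norm (1::'a))) \<longlonglongrightarrow> 0"
      using q by (intro tendsto_mult_left_zero LIMSEQ_power_zero) auto
    ultimately show ?thesis unfolding good_def by (rule Lim_null_comparison)
  qed
  have "good (min T (real m * (h / 2)))" for m
  proof (induction m)
    case 0
    have "(\<lambda>n. (0::'a) ^ n) \<longlonglongrightarrow> 0"
      by (rule LIMSEQ_imp_Suc) simp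
    then show ?case using \<open>T \<ge> 0\<close> by (simp add: good_def y_def)
  next
    case (Suc m)
    have "good (min T (real m * (h / 2)) + (min T (real (Suc m) * (h / 2)) - min T (real m * (h / 2))))"
      using h \<open>T \<ge> 0\<close> by (intro step Suc) (auto simp: min_def algebra_simps)
    then show ?case by simp
  qed
  moreover obtain m :: nat where "T / (h / 2) < real m" using reals_Archimedean2 by blast
  then have "min T (real m * (h / 2)) = T" using h by (simp add: field_simps min_def)
  ultimately have "good T" by metis
  then have "(\<lambda>n. norm (y T ^ n)) \<longlonglongrightarrow> 0" by (simp add: good_def tendsto_norm_zero)
  then show ?thesis
    using \<open>T \<ge> 0\<close> by (simp add: y_def power_mult_distrib norm_scal_mult norm_power flip: scal_power)
qed

lemma quasinilpotent_in_radical: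
  fixes x :: "'a::{complex_banach_algebra, comm_ring_1}"
  assumes "\<And>T. T \<ge> 0 \<Longrightarrow> (\<lambda>n. T ^ n * norm (x ^ n)) \<longlonglongrightarrow> 0"
  shows "x \<in> jacobson_radical"
proof -
  have "(1 - y * x) dvd 1" for y
  proof (rule one_minus_dvd_1_if_summable)
    define T where "T = 2 * norm y"
    have "(\<lambda>n. T ^ n * norm (x ^ n)) \<longlonglongrightarrow> 0" by (rule assms) (simp add: T_def)
    then have "eventually (\<lambda>n. T ^ n * norm (x ^ n) < 1) sequentially"
      by (rule order_tendstoD) simp
    then have "eventually (\<lambda>n. norm ((y * x) ^ n) \<le> norm (1::'a) * (1 / 2) ^ n) sequentially"
    proof eventually_elim
      case (elim n)
      have "norm ((y * x) ^ n) \<le> norm (y ^ n) * norm (x ^ n)"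
        by (simp add: power_mult_distrib norm_mult_ineq)
      also have "\<dots> \<le> (norm (1::'a) * norm y ^ n) * norm (x ^ n)"
        by (intro mult_right_mono norm_power_le) auto
      also have "\<dots> = norm (1::'a) * (1 / 2) ^ n * (T ^ n * norm (x ^ n))"
        by (simp add: T_def power_mult_distrib power_one_over)
      also have "\<dots> \<le> norm (1::'a) * (1 / 2) ^ n * 1"
        using elim by (intro mult_left_mono) auto
      finally show ?case by simp
    qed
    moreover have "summable (\<lambda>n. norm (1::'a) * (1 / 2) ^ n)"
      by (intro summable_mult summable_geometric) auto
    ultimately show "summable (\<lambda>n. (y * x) ^ n)"
      by (rule summable_comparison_test_ev)
  qed
  then show ?thesis
    by (simp add: jacobson_radical_def quasi_invertible_iff_dvd_1 scaleC_eq_scal flip: distrib_right)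
qed

section \<open>Bounded derivations\<close>

text \<open>The Kleinecke--Shirokov argument: \<open>comm_by a\<close> is the inner derivation of the operator algebra
  induced by multiplication with \<open>a\<close>; applied \<open>n\<close> times to \<open>D ^^ n\<close> it leaves
  multiplication by \<open>n! (D a)^n\<close>.\<close>
definition comm_by :: "'a::comm_ring_1 \<Rightarrow> ('a \<Rightarrow> 'a) \<Rightarrow> 'a \<Rightarrow> 'a" where
  "comm_by a T x = T (a * x) - a * T x"

lemma comm_by_add:
  assumes "\<And>x y. T (x + y) = T x + T (y::'a::comm_ring_1)"
  shows "comm_by a T (x + y) = comm_by a T x + comm_by a T y"
  by (simp add: comm_by_def assms algebra_simps)

lemma comm_by_pow_add:
  assumes "\<And>x y. T (x + y) = T x + T (y::'a::comm_ring_1)"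
  shows "(comm_by a ^^ n) T (x + y) = (comm_by a ^^ n) T x + (comm_by a ^^ n) T y"
  by (induction n arbitrary: x y) (simp_all add: assms comm_by_add)

lemma comm_by_pow_compose:
  fixes a :: "'a::comm_ring_1"
  assumes add: "\<And>x y. T (x + y) = T x + T y" and leib: "\<And>x y. D (x * y) = D x * y + x * D y"
  shows "(comm_by a ^^ Suc n) (T \<circ> D) x
    = (comm_by a ^^ Suc n) T (D x) + of_nat (Suc n) * (comm_by a ^^ n) T (D a * x)"
proof (induction n arbitrary: x)
  case 0
  then show ?case by (simp add: comm_by_def leib add)
next
  case (Suc n)
  define U where "U k = (comm_by a ^^ k) T" for k
  have U: "U (Suc k) x = U k (a * x) - a * U k x" for k x
    by (simp add: U_def comm_by_def)
  have Uadd: "U k (x + y) = U k x + U k y" for k x y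
    unfolding U_def by (rule comm_by_pow_add) (rule add)
  have "(comm_by a ^^ Suc (Suc n)) (T \<circ> D) x
     = (comm_by a ^^ Suc n) (T \<circ> D) (a * x) - a * (comm_by a ^^ Suc n) (T \<circ> D) x"
    by (simp add: comm_by_def)
  also have "\<dots> = U (Suc n) (D (a * x)) + of_nat (Suc n) * U n (D a * (a * x))
      - a * (U (Suc n) (D x) + of_nat (Suc n) * U n (D a * x))"
    by (simp only: Suc U_def)
  also have "\<dots> = U (Suc (Suc n)) (D x) + of_nat (Suc (Suc n)) * U (Suc n) (D a * x)"
  proof -
    have 1: "U (Suc n) (D (a * x)) = U (Suc n) (D a * x) + U (Suc n) (a * D x)"
      by (simp only: leib Uadd)
    have 2: "U (Suc n) (a * D x) = U (Suc (Suc n)) (D x) + a * U (Suc n) (D x)"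
      by (simp only: U[of "Suc n"] diff_add_cancel)
    have 3: "U n (D a * (a * x)) = U (Suc n) (D a * x) + a * U n (D a * x)"
      by (simp only: U[of n] diff_add_cancel mult.left_commute)
    show ?thesis unfolding 1 2 3 of_nat_Suc by (simp add: algebra_simps)
  qed
  finally show ?case by (simp only: U_def)
qed

lemma comm_by_pow_derivation_pow:
  fixes a :: "'a::comm_ring_1"
  assumes add: "\<And>x y. D (x + y) = D x + D y" and leib: "\<And>x y. D (x * y) = D x * y + x * D y"
  shows "(comm_by a ^^ n) (D ^^ n) x = of_nat (fact n) * D a ^ n * x
    \<and> (comm_by a ^^ Suc n) (D ^^ n) x = 0"
proof (induction n arbitrary: x)
  case 0
  then show ?case by (simp add: comm_by_def)
next
  case (Suc n)
  have addn: "(D ^^ n) (x + y) = (D ^^ n) x + (D ^^ n) y" for x y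
    by (induction n) (simp_all add: add)
  have "(comm_by a ^^ Suc n) (D ^^ n) = (\<lambda>_. 0)" using Suc by blast
  then have z: "(comm_by a ^^ Suc (Suc n)) (D ^^ n) x = 0" for x
    by (simp only: funpow.simps(2)[of "Suc n"] o_apply) (simp add: comm_by_def)
  have comp: "D ^^ Suc n = (D ^^ n) \<circ> D" by (rule funpow_Suc_right)
  show ?case
    unfolding comp comm_by_pow_compose[OF addn leib] using Suc z
    by (simp add: algebra_simps)
qed

lemma norm_comm_by_pow_le:
  fixes a :: "'a::{complex_banach_algebra, comm_ring_1}"
  assumes "\<And>x. norm (T x) \<le> K * norm x" and "K \<ge> 0"
  shows "norm ((comm_by a ^^ n) T x) \<le> (2 * norm a) ^ n * K * norm x"
proof (induction n arbitrary: x)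
  case 0
  then show ?case using assms by simp
next
  case (Suc n)
  define c where "c = (2 * norm a) ^ n * K"
  have c: "c \<ge> 0" using assms by (simp add: c_def)
  have "norm ((comm_by a ^^ Suc n) T x)
      \<le> norm ((comm_by a ^^ n) T (a * x)) + norm (a * (comm_by a ^^ n) T x)"
    by (simp add: comm_by_def norm_triangle_ineq4)
  also have "norm ((comm_by a ^^ n) T (a * x)) \<le> c * norm (a * x)"
    using Suc by (simp add: c_def)
  also have "\<dots> \<le> c * (norm a * norm x)"
    using c by (intro mult_left_mono norm_mult_ineq)
  also have "norm (a * (comm_by a ^^ n) T x) \<le> norm a * norm ((comm_by a ^^ n) T x)"
    by (rule norm_mult_ineq)
  also have "\<dots> \<le> norm a * (c * norm x)"
    using Suc by (intro mult_left_mono) (auto simp: c_def)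
  finally show ?case by (simp add: c_def algebra_simps)
qed

lemma bounded_derivation_in_radical:
  fixes D :: "'a::{complex_banach_algebra, comm_ring_1} \<Rightarrow> 'a"
  assumes add: "\<And>x y. D (x + y) = D x + D y" and leib: "\<And>x y. D (x * y) = D x * y + x * D y"
    and bd: "\<And>x. norm (D x) \<le> K * norm x"
  shows "D a \<in> jacobson_radical"
proof (rule quasinilpotent_in_radical)
  fix T :: real assume T: "T \<ge> 0"
  have K: "K \<ge> 0"
    using order_trans[OF norm_ge_zero bd[of 1]] by (simp add: zero_le_mult_iff)
  have pow: "norm ((D ^^ n) x) \<le> K ^ n * norm x" for n x
  proof (induction n)
    case (Suc n)
    have "norm ((D ^^ Suc n) x) \<le> K * norm ((D ^^ n) x)" by (simp add: bd)
    also have "\<dots> \<le> K * (K ^ n * norm x)" using K Suc by (intro mult_left_mono) auto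
    finally show ?case by simp
  qed simp
  define c where "c = 2 * norm a * K * T"
  have le: "norm (T ^ n * norm (D a ^ n)) \<le> norm (1::'a) * (c ^ n / fact n)" for n
  proof -
    have "fact n * norm (D a ^ n) = norm (scal (of_nat (fact n)) * D a ^ n)"
      by (simp add: norm_scal_mult)
    also have "\<dots> = norm ((comm_by a ^^ n) (D ^^ n) 1)"
      using comm_by_pow_derivation_pow[of D n a 1, OF add leib] by (simp only: scal_of_nat mult_1_right)
    also have "\<dots> \<le> (2 * norm a) ^ n * K ^ n * norm (1::'a)"
      by (rule norm_comm_by_pow_le[OF pow]) (use K in simp)
    finally have "norm (D a ^ n) \<le> (2 * norm a) ^ n * K ^ n * norm (1::'a) / fact n"
      by (simp add: field_simps)
    then have "T ^ n * norm (D a ^ n) \<le> T ^ n * ((2 * norm a) ^ n * K ^ n * norm (1::'a) / fact n)"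
      using T by (intro mult_left_mono) auto
    then show ?thesis using T by (simp add: c_def power_mult_distrib algebra_simps)
  qed
  have "(\<lambda>n. norm (1::'a) * (c ^ n / fact n)) \<longlonglongrightarrow> 0"
    using summable_LIMSEQ_zero[OF summable_exp[of c]]
    by (intro tendsto_mult_right_zero) (simp add: field_simps)
  then show "(\<lambda>n. T ^ n * norm (D a ^ n)) \<longlonglongrightarrow> 0"
    by (rule Lim_null_comparison[OF always_eventually[OF allI[OF le]]])
qed

section \<open>Automatic continuity\<close>

lemma Baire_cover_interior:
  fixes V :: "nat \<Rightarrow> 'a::{complete_space} set"
  assumes "\<And>n. closed (V n)" and "(\<Union>n. V n) = UNIV"
  obtains n where "interior (V n) \<noteq> {}"
proof (rule ccontr)
  assume "\<not> thesis"
  then have empty: "interior (V n) = {}" for n using that by blast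
  have "euclidean interior_of \<Union>(range V) = {}"
    by (rule Baire_category_alt)
      (use assms empty completely_metrizable_space_euclidean in auto)
  then show False using assms(2) by simp
qed

definition separating_space :: "('a::real_normed_vector \<Rightarrow> 'b::real_normed_vector) \<Rightarrow> 'b set" where
  "separating_space T = {s. \<forall>\<epsilon>>0. \<exists>x. norm x < \<epsilon> \<and> norm (T x - s) < \<epsilon>}"

lemma closed_graph_bounded:
  fixes D :: "'a::banach \<Rightarrow> 'b::banach"
  assumes lin: "linear D"
    and sep: "separating_space D \<subseteq> {0}"
  obtains K where "\<And>x. norm (D x) \<le> K * norm x"
proof -
  interpret D: linear D by (rule lin)
  define V where "V n = closure {x. norm (D x) \<le> real n}" for n
  have "x \<in> (\<Union>n. V n)" for x
  proof -
    obtain n where "norm (D x) \<le> real n" using real_arch_simple by blast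
    then have "x \<in> V n" unfolding V_def by (intro subsetD[OF closure_subset]) simp
    then show ?thesis by blast
  qed
  then have "(\<Union>n. V n) = UNIV" by blast
  then obtain n where "interior (V n) \<noteq> {}"
    using Baire_cover_interior[of V] unfolding V_def by (metis closed_closure)
  then obtain a r where r: "r > 0" and ball: "ball a r \<subseteq> V n"
    by (meson all_not_in_conv mem_interior)
  define C where "C = 2 * (real n + 1) / r"
  have C: "C > 0" using r by (simp add: C_def)
  have approx: "\<exists>y. norm (D y) \<le> C * \<rho> \<and> norm (x - y) < \<rho>'"
    if x: "norm x < \<rho>" and pos: "\<rho> > 0" "\<rho>' > 0" for x \<rho> \<rho>'
  proof -
    define t where "t = r / \<rho>"
    have t: "t > 0" using r pos by (simp add: t_def)
    have "norm (t *\<^sub>R x) < r"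
    proof -
      have "norm (t *\<^sub>R x) = t * norm x" using t by simp
      also have "\<dots> < t * \<rho>" using x t by simp
      finally show ?thesis using pos by (simp add: t_def)
    qed
    then have "a + t *\<^sub>R x \<in> V n" "a \<in> V n"
      using ball r by (auto simp: subset_iff dist_norm)
    moreover have "t * \<rho>' / 2 > 0" using t pos by simp
    ultimately have "\<exists>u\<in>{x. norm (D x) \<le> real n}. norm (u - (a + t *\<^sub>R x)) < t * \<rho>' / 2"
      "\<exists>v\<in>{x. norm (D x) \<le> real n}. norm (v - a) < t * \<rho>' / 2"
      unfolding V_def closure_approachable dist_norm by blast+
    then obtain u v where u: "norm (D u) \<le> real n" "norm (u - (a + t *\<^sub>R x)) < t * \<rho>' / 2"
      and v: "norm (D v) \<le> real n" "norm (v - a) < t * \<rho>' / 2"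
      by blast
    define y where "y = (1 / t) *\<^sub>R (u - v)"
    have "norm (D y) = (1 / t) * norm (D u - D v)"
      using t by (simp add: y_def D.scale D.diff)
    also have "\<dots> \<le> (1 / t) * (real n + real n)"
      using t u v norm_triangle_ineq4[of "D u" "D v"] by (intro mult_left_mono) auto
    also have "\<dots> \<le> C * \<rho>" using r pos by (simp add: t_def C_def field_simps)
    finally have 1: "norm (D y) \<le> C * \<rho>" .
    have "x - y = (1 / t) *\<^sub>R ((v - a) - (u - (a + t *\<^sub>R x)))"
      using t by (simp add: y_def algebra_simps)
    then have "norm (x - y) = (1 / t) * norm ((v - a) - (u - (a + t *\<^sub>R x)))"
      using t by simp
    also have "\<dots> \<le> (1 / t) * (norm (v - a) + norm (u - (a + t *\<^sub>R x)))"
      using t by (intro mult_left_mono norm_triangle_ineq4) auto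
    also have "\<dots> < (1 / t) * (t * \<rho>')"
      using t u v by (intro mult_strict_left_mono) auto
    finally have 2: "norm (x - y) < \<rho>'" using t by simp
    show ?thesis using 1 2 by blast
  qed
  have unit: "norm (D x) \<le> 2 * C" if x: "norm x < 1" for x
  proof -
    have "\<exists>y. norm x < (1 / 2) ^ m \<longrightarrow> norm (D y) \<le> C * (1 / 2) ^ m \<and> norm (x - y) < (1 / 2) ^ Suc m"
      for x and m :: nat
      using approx[of x "(1 / 2) ^ m" "(1 / 2) ^ Suc m"] by (cases "norm x < (1 / 2) ^ m") simp_all
    then obtain Y where Y: "\<And>x m. norm x < (1 / 2) ^ m \<Longrightarrow>
        norm (D (Y x m)) \<le> C * (1 / 2) ^ m \<and> norm (x - Y x m) < (1 / 2) ^ Suc m"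
      by metis
    define w where "w = rec_nat x (\<lambda>m z. z - Y z m)"
    have w0: "w 0 = x" and wSuc: "w (Suc m) = w m - Y (w m) m" for m
      by (simp_all add: w_def)
    have w: "norm (w m) < (1 / 2) ^ m" for m
      by (induction m) (use x Y w0 wSuc in auto)
    define z where "z m = D (Y (w m) m)" for m
    have zn: "norm (z m) \<le> C * (1 / 2) ^ m" for m
      using Y[OF w] by (simp add: z_def)
    have summ: "summable (\<lambda>m. C * (1 / 2) ^ m)"
      by (intro summable_mult summable_geometric) auto
    have sumz: "summable z"
      by (rule summable_comparison_test'[OF summ]) (rule zn)
    have bound: "norm (suminf z) \<le> 2 * C"
    proof -
      have "norm (suminf z) \<le> (\<Sum>m. C * (1 / 2) ^ m)"
        by (rule norm_suminf_le[OF zn summ])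
      also have "\<dots> = C * 2"
        by (subst suminf_mult) (auto simp: suminf_geometric summable_geometric)
      finally show ?thesis by simp
    qed
    have part: "D (w m) = D x - (\<Sum>i<m. z i)" for m
      by (induction m) (simp_all add: w0 wSuc D.diff z_def)
    have "(\<lambda>m. D x - (\<Sum>i<m. z i)) \<longlonglongrightarrow> D x - suminf z"
      by (intro tendsto_diff tendsto_const summable_LIMSEQ sumz)
    then have lim: "(\<lambda>m. D (w m)) \<longlonglongrightarrow> D x - suminf z" by (simp add: part)
    have "D x - suminf z \<in> separating_space D"
      unfolding separating_space_def
    proof (intro CollectI allI impI)
      fix \<epsilon> :: real assume \<epsilon>: "\<epsilon> > 0"
      have "eventually (\<lambda>m. (1 / 2 :: real) ^ m < \<epsilon>) sequentially"
        using LIMSEQ_power_zero[of "1 / 2 :: real"] \<epsilon> by (auto dest: order_tendstoD)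
      moreover have "eventually (\<lambda>m. norm (D (w m) - (D x - suminf z)) < \<epsilon>) sequentially"
        using tendstoD[OF lim \<epsilon>] by (simp add: dist_norm)
      ultimately have "eventually (\<lambda>m. norm (w m) < \<epsilon> \<and> norm (D (w m) - (D x - suminf z)) < \<epsilon>) sequentially"
        by eventually_elim (use w in \<open>auto intro: less_trans\<close>)
      then show "\<exists>x'. norm x' < \<epsilon> \<and> norm (D x' - (D x - suminf z)) < \<epsilon>"
        by (auto dest: eventually_happens)
    qed
    then have "D x = suminf z" using sep by auto
    then show ?thesis using bound by simp
  qed
  show ?thesis
  proof (rule that[of "4 * C"])
    fix x
    show "norm (D x) \<le> 4 * C * norm x"
    proof (cases "x = 0")
      case False
      define c where "c = 1 / (2 * norm x)"
      have c: "c > 0" using False by (simp add: c_def)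
      have "norm (D (c *\<^sub>R x)) \<le> 2 * C"
        by (rule unit) (use False in \<open>simp add: c_def\<close>)
      then have "c * norm (D x) \<le> 2 * C" using c by (simp add: D.scale)
      then show ?thesis using False by (simp add: c_def field_simps)
    qed (simp add: D.zero)
  qed
qed

lemma derivation_add: "derivation D \<Longrightarrow> D (x + y) = D x + D y"
  by (simp add: derivation_def clinear_map_def)

lemma derivation_mult: "derivation D \<Longrightarrow> D (x * y) = D x * y + x * D y"
  by (simp add: derivation_def)

lemma derivation_linear: "derivation D \<Longrightarrow> linear D"
  by (intro linearI) (simp_all add: derivation_def clinear_map_def flip: scaleC_of_real)

lemma derivation_scal_mult:
  "derivation D \<Longrightarrow> D (scal z * x) = scal z * D (x::'a::{complex_banach_algebra, comm_ring_1})"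
  by (simp add: derivation_def clinear_map_def flip: scaleC_eq_scal)

lemma derivation_scal:
  assumes "derivation D"
  shows "D (scal z) = (0::'a::{complex_banach_algebra, comm_ring_1})"
proof -
  have "D 1 = 0" using derivation_mult[OF assms, of 1 1] by simp
  then show ?thesis using derivation_scal_mult[OF assms, of z 1] by simp
qed

definition eval_at :: "'a::{complex_banach_algebra, comm_ring_1} \<Rightarrow> complex poly \<Rightarrow> 'a" where
  "eval_at b p = poly (map_poly scal p) b"

lemma eval_at_0 [simp]: "eval_at b 0 = 0"
  by (simp add: eval_at_def)

lemma eval_at_pCons [simp]: "eval_at b (pCons c p) = scal c + b * eval_at b p"
  by (simp add: eval_at_def map_poly_pCons)

lemma eval_at_1 [simp]: "eval_at b 1 = 1"
  by (simp add: one_pCons)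

lemma eval_at_add: "eval_at b (p + q) = eval_at b p + eval_at b q"
proof (induction p arbitrary: q)
  case (pCons c p)
  obtain c' q' where "q = pCons c' q'" by (cases q)
  then show ?case by (simp add: pCons scal_add algebra_simps)
qed simp

lemma eval_at_smult: "eval_at b (smult c p) = scal c * eval_at b p"
  by (induction p) (simp_all add: scal_mult algebra_simps)

lemma eval_at_diff: "eval_at b (p - q) = eval_at b p - eval_at b q"
  using eval_at_add[of b "p - q" q] by simp

lemma eval_at_mult: "eval_at b (p * q) = eval_at b p * eval_at b q"
  by (induction p) (simp_all add: eval_at_add eval_at_smult algebra_simps)

lemma eval_at_dvd_1:
  assumes "p \<noteq> 0" and "\<And>\<mu>. poly p \<mu> = 0 \<Longrightarrow> (b - scal \<mu>) dvd 1"
  shows "eval_at b p dvd 1"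
  using assms
proof (induction "degree p" arbitrary: p rule: less_induct)
  case less
  show ?case
  proof (cases "degree p = 0")
    case True
    then obtain c where "p = [:c:]" by (rule degree_eq_zeroE)
    then show ?thesis using less.prems(1) by (simp add: scal_dvd_1)
  next
    case False
    then have "\<not> constant (poly p)" by (simp add: constant_degree)
    then obtain \<mu> where \<mu>: "poly p \<mu> = 0" using fundamental_theorem_of_algebra by blast
    then obtain q where q: "p = [:- \<mu>, 1:] * q" by (auto simp: poly_eq_0_iff_dvd elim: dvdE)
    have "q \<noteq> 0" using q less.prems(1) by auto
    then have "degree p = Suc (degree q)" unfolding q by (subst degree_mult_eq) auto
    then have "eval_at b q dvd 1"
      using \<open>q \<noteq> 0\<close> by (intro less.hyps less.prems(2)) (auto simp: q)
    moreover have "eval_at b p = (b - scal \<mu>) * eval_at b q"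
      unfolding q eval_at_mult by (simp add: scal_minus)
    ultimately show ?thesis
      using mult_dvd_mono[OF less.prems(2)[OF \<mu>], of "eval_at b q" 1] by simp
  qed
qed

lemma derivation_eval_at:
  assumes "derivation D"
  shows "D (eval_at b p) = eval_at b (pderiv p) * D b"
proof (induction p)
  case 0
  then show ?case using derivation_scal[OF assms, of 0] by simp
next
  case (pCons c p)
  then show ?case
    by (simp add: derivation_add[OF assms] derivation_mult[OF assms] derivation_scal[OF assms]
        pderiv_pCons eval_at_add algebra_simps)
qed

text \<open>For finite spectrum, \<open>b\<close> is a root of a polynomial with simple zeros.\<close>
lemma derivation_eq_0_if_finite_spectrum:
  fixes b :: "'a::{complex_banach_algebra, comm_ring_1}"
  assumes D: "derivation D" and semisimple: "jacobson_radical = {0::'a}"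
    and fin: "finite {z. z \<noteq> 0 \<and> \<not> (b - scal z) dvd 1}"
  shows "D b = 0"
proof -
  define F where "F = insert 0 {z. z \<noteq> 0 \<and> \<not> (b - scal z) dvd 1}"
  have F: "finite F" "0 \<in> F" using fin by (auto simp: F_def)
  have unit: "(b - scal \<mu>) dvd 1" if "\<mu> \<notin> F" for \<mu> using that by (auto simp: F_def)
  define q where "q = (\<Prod>\<nu>\<in>F. [:- \<nu>, 1:])"
  have root: "poly q \<nu> = 0" if "\<nu> \<in> F" for \<nu>
    unfolding q_def poly_prod using F that by (auto intro!: prod_zero bexI[of _ \<nu>])
  have "(1 - scal z * eval_at b q) dvd 1" for z
  proof -
    have "eval_at b (1 - smult z q) dvd 1"
    proof (rule eval_at_dvd_1)
      show "1 - smult z q \<noteq> 0"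
      proof
        assume "1 - smult z q = 0"
        then have "poly (1 - smult z q) 0 = 0" by simp
        then show False using root[OF F(2)] by simp
      qed
      show "(b - scal \<mu>) dvd 1" if "poly (1 - smult z q) \<mu> = 0" for \<mu>
        using that root by (intro unit) auto
    qed
    then show ?thesis by (simp add: eval_at_diff eval_at_smult)
  qed
  then have "eval_at b q \<in> jacobson_radical"
    by (intro quasinilpotent_in_radical quasinilpotent_powers_tendsto_0)
  then have "eval_at b q = 0" unfolding semisimple by blast
  then have *: "eval_at b (pderiv q) * D b = 0"
    using derivation_eval_at[OF D, of b q] derivation_scal[OF D, of 0] by simp
  have simple: "poly (pderiv q) \<nu> \<noteq> 0" if "\<nu> \<in> F" for \<nu>
  proof -
    have "q = [:- \<nu>, 1:] * (\<Prod>\<nu>\<in>F - {\<nu>}. [:- \<nu>, 1:])"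
      unfolding q_def using F that by (intro prod.remove)
    then have "poly (pderiv q) \<nu> = (\<Prod>\<mu>\<in>F - {\<nu>}. \<nu> - \<mu>)"
      by (simp add: pderiv_mult pderiv_pCons poly_prod del: mult_pCons_left)
    then show ?thesis using F by auto
  qed
  have "eval_at b (pderiv q) dvd 1"
  proof (rule eval_at_dvd_1)
    show "pderiv q \<noteq> 0" using simple[OF F(2)] by auto
    show "(b - scal \<mu>) dvd 1" if "poly (pderiv q) \<mu> = 0" for \<mu>
      using simple that by (intro unit) auto
  qed
  then obtain c where "1 = eval_at b (pderiv q) * c" by (auto elim: dvdE)
  then have "D b = c * (eval_at b (pderiv q) * D b)" by (metis mult.assoc mult.commute mult_1)
  then show ?thesis using * by simp
qed

lemma separating_space_ideal:
  fixes D :: "'a::{complex_banach_algebra, comm_ring_1} \<Rightarrow> 'a"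
  assumes D: "derivation D" and s: "s \<in> separating_space D"
  shows "a * s \<in> separating_space D"
  unfolding separating_space_def
proof (intro CollectI allI impI)
  fix \<epsilon> :: real assume \<epsilon>: "\<epsilon> > 0"
  define M where "M = 1 + norm a + norm (D a)"
  have M: "M > 0" by (simp add: M_def add_pos_nonneg)
  define \<eta> where "\<eta> = \<epsilon> / M"
  have \<eta>: "\<eta> > 0" using \<epsilon> M by (simp add: \<eta>_def)
  obtain x where x: "norm x < \<eta>" "norm (D x - s) < \<eta>"
    using s \<eta> by (auto simp: separating_space_def)
  have bound: "r * norm x < \<epsilon> \<and> r * norm x + r' * norm (D x - s) < \<epsilon>"
    if "r \<ge> 0" "r' \<ge> 0" "r + r' < M" for r r'
  proof -
    have "r * norm x + r' * norm (D x - s) \<le> r * \<eta> + r' * \<eta>"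
      using x that by (intro add_mono mult_left_mono) auto
    also have "\<dots> < M * \<eta>" using that \<eta> by (simp flip: distrib_right)
    finally have "r * norm x + r' * norm (D x - s) < \<epsilon>" using M by (simp add: \<eta>_def)
    moreover have "r' * norm (D x - s) \<ge> 0" using that by simp
    ultimately show ?thesis by linarith
  qed
  have "norm (a * x) < \<epsilon>"
    using norm_mult_ineq[of a x] bound[of "norm a" 0]
    by (simp add: M_def add_pos_nonneg)
  moreover have "D (a * x) - a * s = D a * x + a * (D x - s)"
    by (simp add: derivation_mult[OF D] algebra_simps)
  then have "norm (D (a * x) - a * s) \<le> norm (D a) * norm x + norm a * norm (D x - s)"
    using norm_triangle_ineq[of "D a * x" "a * (D x - s)"] norm_mult_ineq[of "D a" x]
      norm_mult_ineq[of a "D x - s"] by simp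
  then have "norm (D (a * x) - a * s) < \<epsilon>"
    using bound[of "norm (D a)" "norm a"] by (simp add: M_def)
  ultimately show "\<exists>y. norm y < \<epsilon> \<and> norm (D y - a * s) < \<epsilon>" by blast
qed

lemma prod_minus_scal_remainder:
  fixes b :: "'a::{complex_banach_algebra, comm_ring_1}" and l :: "nat \<Rightarrow> complex"
  shows "(b - scal \<mu>) dvd ((\<Prod>j<n. b - scal (l j)) - scal (\<Prod>j<n. \<mu> - l j))"
proof (induction n)
  case (Suc n)
  have "(\<Prod>j<Suc n. b - scal (l j)) - scal (\<Prod>j<Suc n. \<mu> - l j)
     = ((\<Prod>j<n. b - scal (l j)) - scal (\<Prod>j<n. \<mu> - l j)) * (b - scal (l n))
       + (b - scal \<mu>) * scal (\<Prod>j<n. \<mu> - l j)"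
    by (simp add: scal_mult scal_diff algebra_simps)
  then show ?case using Suc by (simp add: dvd_add)
qed simp

text \<open>A gliding hump: if \<open>l\<close> enumerated infinitely many nonzero spectral values, then with
  \<open>T n = (\<Prod>j<n. b - l j)\<close> the vectors \<open>T n * b\<close> would keep a positive distance from the ideals
  \<open>T (Suc n) * A\<close>, and a series \<open>\<Sum>k. T k * x k\<close> with \<open>x k\<close> tiny and \<open>D (x k)\<close> close to a large
  multiple of \<open>b\<close> would have an image of infinite norm.\<close>
lemma separating_space_finite_spectrum:
  fixes D :: "'a::{complex_banach_algebra, comm_ring_1} \<Rightarrow> 'a"
  assumes D: "derivation D" and b: "b \<in> separating_space D"
  shows "finite {z. z \<noteq> 0 \<and> \<not> (b - scal z) dvd 1}"
proof (rule ccontr)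
  assume "\<not> ?thesis"
  then obtain l :: "nat \<Rightarrow> complex" where l: "inj l" "range l \<subseteq> {z. z \<noteq> 0 \<and> \<not> (b - scal z) dvd 1}"
    using infinite_countable_subset[of "{z. z \<noteq> 0 \<and> \<not> (b - scal z) dvd 1}"] by metis
  have l_ne: "l n \<noteq> 0" and l_nonunit: "\<not> (b - scal (l n)) dvd 1" for n
    using subsetD[OF l(2) rangeI[of l n]] by simp_all
  define T where "T n = (\<Prod>j<n. b - scal (l j))" for n
  define P where "P m n = (\<Prod>j\<in>{m..<n}. b - scal (l j))" for m n
  have TSuc: "T (Suc n) = T n * (b - scal (l n))" for n by (simp add: T_def)
  have TP: "T (k + m) = T m * P m (k + m)" for k m
    unfolding T_def P_def by (subst prod.union_disjoint[symmetric]) (auto intro!: prod.cong)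
  have far: "\<exists>\<eta>>0. \<forall>y. \<eta> \<le> norm (T n * b - T (Suc n) * y)" for n
  proof -
    define c where "c = (\<Prod>j<n. l n - l j) * l n"
    have c: "c \<noteq> 0" using l(1) l_ne by (auto simp: c_def inj_def)
    obtain v where v: "T n - scal (\<Prod>j<n. l n - l j) = (b - scal (l n)) * v"
      using prod_minus_scal_remainder[of b "l n" l n] by (auto simp: T_def elim: dvdE)
    have "cmod c \<le> norm (T n * b - T (Suc n) * y)" for y
    proof -
      define u where "u = scal (1 / c) * (T n * y - (v * b + scal (\<Prod>j<n. l n - l j)))"
      have Tn: "T n = scal (\<Prod>j<n. l n - l j) + (b - scal (l n)) * v" using v by (simp add: algebra_simps)
      have Tb: "T n * b = scal c + (b - scal (l n)) * (v * b + scal (\<Prod>j<n. l n - l j))"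
        by (subst Tn) (simp add: c_def scal_mult algebra_simps)
      have cu: "scal c * u = T n * y - (v * b + scal (\<Prod>j<n. l n - l j))"
        unfolding u_def mult.assoc[symmetric] using c by (simp flip: scal_mult)
      have "T n * b - T (Suc n) * y = scal c - (b - scal (l n)) * (scal c * u)"
        unfolding TSuc Tb cu by (simp add: algebra_simps)
      then have "T n * b - T (Suc n) * y = scal c * (1 - (b - scal (l n)) * u)"
        by (simp add: algebra_simps)
      then have "norm (T n * b - T (Suc n) * y) = cmod c * norm (1 - (b - scal (l n)) * u)"
        by (simp only: norm_scal_mult)
      moreover have "norm (1 - (b - scal (l n)) * u) \<ge> 1"
        by (rule norm_one_minus_nonunit[OF l_nonunit])
      ultimately show ?thesis by (simp add: mult_le_cancel_left1)
    qed
    then show ?thesis using c by (intro exI[of _ "cmod c"]) auto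
  qed
  define e where "e n = (1 / 2) ^ n / (1 + (\<Sum>m\<le>n. norm (P m n)))" for n
  have e_pos: "e n > 0" for n
    unfolding e_def by (intro divide_pos_pos add_pos_nonneg sum_nonneg) auto
  have e_le: "norm (P m n) * e n \<le> (1 / 2) ^ n" if "m \<le> n" for m n
  proof -
    have "norm (P m n) \<le> (\<Sum>m\<le>n. norm (P m n))"
      by (rule member_le_sum) (use that in auto)
    then have "norm (P m n) * (1 / 2) ^ n \<le> (1 + (\<Sum>m\<le>n. norm (P m n))) * (1 / 2) ^ n"
      by (intro mult_right_mono) auto
    moreover have pos: "1 + (\<Sum>m\<le>n. norm (P m n)) > 0" by (intro add_pos_nonneg sum_nonneg) auto
    ultimately show ?thesis
      unfolding e_def times_divide_eq_right pos_divide_le_eq[OF pos] by (simp only: mult.commute)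
  qed
  have "\<exists>x. norm x \<le> e n \<and> (\<forall>y. real n + norm (D (T (Suc n))) \<le> norm (D (p + T n * x) - T (Suc n) * y))"
    for n p
  proof -
    obtain \<eta> where \<eta>: "\<eta> > 0" "\<And>y. \<eta> \<le> norm (T n * b - T (Suc n) * y)" using far by blast
    define s where "s = real n + norm (D (T (Suc n))) + norm (D p) + norm (T n) + norm (D (T n))"
    define K where "K = s / \<eta> + 1"
    have s: "s \<ge> 0" by (simp add: s_def)
    have K: "K > 0" using s \<eta> by (simp add: K_def add_nonneg_pos)
    have Ks: "K * \<eta> \<ge> s" using \<eta> by (simp add: K_def field_simps)
    define e0 where "e0 = min (e n) 1 / K"
    have "e0 > 0" using e_pos[of n] K by (simp add: e0_def)
    then obtain x' where x': "norm x' < e0" "norm (D x' - b) < e0"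
      using b by (auto simp: separating_space_def)
    define x where "x = scal (complex_of_real K) * x'"
    have Ke0: "K * e0 = min (e n) 1" using K by (simp add: e0_def)
    have "norm x = K * norm x'" using K by (simp add: x_def norm_scal_mult)
    also have "\<dots> \<le> K * e0" using K x' by (intro mult_left_mono) auto
    finally have x: "norm x \<le> e n" "norm x \<le> 1" using Ke0 by auto
    define g where "g = D x - scal (complex_of_real K) * b"
    have "g = scal (complex_of_real K) * (D x' - b)"
      unfolding g_def x_def derivation_scal_mult[OF D] by (simp add: algebra_simps)
    then have "norm g = K * norm (D x' - b)" using K by (simp add: norm_scal_mult)
    also have "\<dots> \<le> K * e0" using K x' by (intro mult_left_mono) auto
    finally have g: "norm g \<le> 1" using Ke0 by auto
    have "real n + norm (D (T (Suc n))) \<le> norm (D (p + T n * x) - T (Suc n) * y)" for y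
    proof -
      define y' where "y' = scal (complex_of_real (1 / K)) * y"
      have y': "y = scal (complex_of_real K) * y'"
        unfolding y'_def mult.assoc[symmetric] using K by (simp flip: scal_mult)
      have Dx: "D x = scal (complex_of_real K) * b + g" by (simp add: g_def)
      define h where "h = D p + (D (T n) * x + T n * g)"
      have "D (p + T n * x) - T (Suc n) * y = scal (complex_of_real K) * (T n * b - T (Suc n) * y') + h"
        unfolding y' h_def derivation_add[OF D] derivation_mult[OF D] Dx by (simp add: algebra_simps)
      then have "K * norm (T n * b - T (Suc n) * y') \<le> norm (D (p + T n * x) - T (Suc n) * y) + norm h"
        using K norm_triangle_ineq4[of "D (p + T n * x) - T (Suc n) * y" h]
        by (simp add: norm_scal_mult)
      moreover have "K * \<eta> \<le> K * norm (T n * b - T (Suc n) * y')"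
        using K \<eta> by (intro mult_left_mono) auto
      moreover have "norm h \<le> norm (D p) + (norm (D (T n)) + norm (T n))"
      proof -
        have "norm (D (T n) * x) \<le> norm (D (T n)) * 1"
          using x by (intro norm_mult_ineq[THEN order_trans] mult_left_mono) auto
        moreover have "norm (T n * g) \<le> norm (T n) * 1"
          using g by (intro norm_mult_ineq[THEN order_trans] mult_left_mono) auto
        ultimately show ?thesis
          unfolding h_def
          by (intro norm_triangle_le add_mono order_refl) (use norm_triangle_ineq in auto)
      qed
      ultimately show ?thesis using Ks by (simp add: s_def)
    qed
    then show ?thesis using x by blast
  qed
  then obtain X where X: "\<And>n p. norm (X n p) \<le> e n"
    "\<And>n p y. real n + norm (D (T (Suc n))) \<le> norm (D (p + T n * X n p) - T (Suc n) * y)"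
    by metis
  define p where "p = rec_nat 0 (\<lambda>n p. p + T n * X n p)"
  define x where "x n = X n (p n)" for n
  have p0: "p 0 = 0" and pSuc: "p (Suc n) = p n + T n * x n" for n
    by (simp_all add: p_def x_def)
  have p_sum: "p m = (\<Sum>k<m. T k * x k)" for m
    by (induction m) (simp_all add: p0 pSuc)
  have tail: "norm (P m (k + m) * x (k + m)) \<le> (1 / 2) ^ m * (1 / 2) ^ k" for m k
  proof -
    have "norm (P m (k + m) * x (k + m)) \<le> norm (P m (k + m)) * e (k + m)"
      by (intro norm_mult_ineq[THEN order_trans] mult_left_mono) (auto simp: x_def X)
    also have "\<dots> \<le> (1 / 2) ^ (k + m)" by (rule e_le) simp
    finally show ?thesis by (simp add: power_add mult.commute)
  qed
  have geo: "summable (\<lambda>k. (1 / 2 :: real) ^ m * (1 / 2) ^ k)" for m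
    by (intro summable_mult summable_geometric) auto
  define w where "w m = (\<Sum>k. P m (k + m) * x (k + m))" for m
  have summ: "summable (\<lambda>k. P m (k + m) * x (k + m))" for m
    by (rule summable_comparison_test'[OF geo tail])
  have w_le: "norm (w (Suc n)) \<le> 1" for n
  proof -
    have "norm (w (Suc n)) \<le> (\<Sum>k. (1 / 2) ^ Suc n * (1 / 2) ^ k)"
      unfolding w_def by (rule norm_suminf_le[OF tail geo])
    also have "\<dots> = (1 / 2) ^ Suc n * 2"
      by (subst suminf_mult) (auto simp: suminf_geometric summable_geometric)
    also have "\<dots> \<le> 1" by (simp add: power_le_one)
    finally show ?thesis .
  qed
  define z where "z = (\<Sum>k. T k * x k)"
  have "summable (\<lambda>k. T k * x k)"
    using summ[of 0] by (simp add: P_def T_def atLeast0LessThan)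
  then have split: "z = p m + T m * w m" for m
    using suminf_split_initial_segment[of "\<lambda>k. T k * x k" m] suminf_mult[OF summ, of "T m" m]
    by (simp add: z_def p_sum w_def TP mult.assoc)
  have "real n \<le> norm (D z)" for n
  proof -
    have "D z = D (p (Suc n)) + (D (T (Suc n)) * w (Suc n) + T (Suc n) * D (w (Suc n)))"
      by (simp only: split[of "Suc n"] derivation_add[OF D] derivation_mult[OF D])
    then have "D (p (Suc n)) - T (Suc n) * (- D (w (Suc n))) = D z - D (T (Suc n)) * w (Suc n)"
      by (simp add: algebra_simps)
    moreover have "real n + norm (D (T (Suc n))) \<le> norm (D (p (Suc n)) - T (Suc n) * (- D (w (Suc n))))"
      unfolding pSuc x_def by (rule X)
    ultimately have "real n + norm (D (T (Suc n))) \<le> norm (D z) + norm (D (T (Suc n)) * w (Suc n))"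
      using norm_triangle_ineq4[of "D z" "D (T (Suc n)) * w (Suc n)"] by simp
    moreover have "norm (D (T (Suc n)) * w (Suc n)) \<le> norm (D (T (Suc n))) * 1"
      by (intro norm_mult_ineq[THEN order_trans] mult_left_mono w_le) auto
    ultimately show ?thesis by simp
  qed
  then show False using reals_Archimedean2[of "norm (D z)"] by (meson not_le)
qed

theorem derivation_semisimple_eq_0:
  fixes D :: "'a::{complex_banach_algebra, comm_ring_1} \<Rightarrow> 'a"
  assumes D: "derivation D" and semisimple: "jacobson_radical = {0::'a}"
  shows "D a = 0"
proof -
  have zero: "D b = 0" if "b \<in> separating_space D" for b
    using that by (intro derivation_eq_0_if_finite_spectrum[OF D semisimple]
        separating_space_finite_spectrum[OF D])
  have sep: "s = 0" if sS: "s \<in> separating_space D" for s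
  proof -
    have s: "\<exists>x. norm x < \<epsilon> \<and> norm (D x - s) < \<epsilon>" if "\<epsilon> > 0" for \<epsilon>
      using sS that by (simp add: separating_space_def)
    have sD: "s * D x = 0" for x
    proof -
      have "D (x * s) = 0" by (intro zero separating_space_ideal[OF D] sS)
      then show ?thesis using zero[OF sS] by (simp add: derivation_mult[OF D] mult.commute)
    qed
    have "norm (s * s) \<le> norm s * \<epsilon>" if \<epsilon>: "\<epsilon> > 0" for \<epsilon>
    proof -
      obtain x where "norm (D x - s) < \<epsilon>" using s[OF \<epsilon>] by blast
      moreover have "norm (s * s) = norm (s * (D x - s))"
        using sD[of x] by (simp add: algebra_simps)
      ultimately show ?thesis
        using norm_mult_ineq[of s "D x - s"] mult_left_mono[of "norm (D x - s)" \<epsilon> "norm s"] by simp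
    qed
    then have le: "norm (s * s) \<le> norm s * (\<epsilon> / (norm s + 1))" if "\<epsilon> > 0" for \<epsilon>
      using that by (meson add_nonneg_pos divide_pos_pos norm_ge_zero zero_less_one)
    have "norm (s * s) \<le> 0 + \<epsilon>" if "\<epsilon> > 0" for \<epsilon>
    proof -
      have "norm s * (\<epsilon> / (norm s + 1)) \<le> \<epsilon>"
        using that add_nonneg_pos[OF norm_ge_zero zero_less_one, of s] by (simp add: pos_divide_le_eq algebra_simps)
      then show ?thesis using le[OF that] by simp
    qed
    then have "norm (s * s) \<le> 0" by (rule field_le_epsilon)
    then have "s * s = 0" by simp
    have "s \<in> jacobson_radical"
    proof (rule quasinilpotent_in_radical)
      fix T :: real
      have "s ^ (n + 2) = 0" for n
        using \<open>s * s = 0\<close> unfolding power_add power2_eq_square by simp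
      then have "T ^ (n + 2) * norm (s ^ (n + 2)) = 0" for n by (simp only: norm_zero mult_zero_right)
      then have "(\<lambda>n. T ^ (n + 2) * norm (s ^ (n + 2))) \<longlonglongrightarrow> 0" by (simp only: tendsto_const)
      then show "(\<lambda>n. T ^ n * norm (s ^ n)) \<longlonglongrightarrow> 0" by (rule LIMSEQ_offset)
    qed
    then show "s = 0" unfolding semisimple by blast
  qed
  obtain K where "\<And>x. norm (D x) \<le> K * norm x"
    using closed_graph_bounded[OF derivation_linear[OF D]] sep by blast
  then have "D a \<in> jacobson_radical"
    by (intro bounded_derivation_in_radical) (auto simp: derivation_add[OF D] derivation_mult[OF D])
  then show ?thesis unfolding semisimple by blast
qed

section \<open>Reduction modulo the right annihilator\<close>

lemma quasi_invertible_if_norm_less: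
  fixes x :: "'a::complex_banach_algebra"
  assumes x: "norm x < 1"
  shows "quasi_invertible x"
proof -
  define f where "f n = ((\<lambda>y. x * y) ^^ n) x" for n
  have fSuc: "x * f n = f (Suc n)" for n by (simp add: f_def)
  have fSuc': "f n * x = f (Suc n)" for n
  proof (induction n)
    case 0
    then show ?case by (simp add: f_def)
  next
    case (Suc n)
    then show ?case by (metis fSuc mult.assoc)
  qed
  have f_le: "norm (f n) \<le> norm x * norm x ^ n" for n
  proof (induction n)
    case 0
    then show ?case by (simp add: f_def)
  next
    case (Suc n)
    have "norm (f (Suc n)) \<le> norm x * norm (f n)"
      unfolding fSuc[symmetric] by (rule norm_mult_ineq)
    also have "\<dots> \<le> norm x * (norm x * norm x ^ n)"
      using Suc by (intro mult_left_mono) auto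
    finally show ?case by simp
  qed
  have "summable f"
    by (rule summable_comparison_test'[OF _ f_le]) (use x in \<open>auto intro: summable_mult summable_geometric\<close>)
  moreover from this have "(\<Sum>n. f (Suc n)) = suminf f - x"
    using suminf_split_head[of f] by (simp add: f_def)
  ultimately have "x * suminf f = suminf f - x" "suminf f * x = suminf f - x"
    using suminf_mult[of f x] suminf_mult2[of f x] by (simp_all add: fSuc fSuc')
  then have "x + (- suminf f) - x * (- suminf f) = 0 \<and> x + (- suminf f) - (- suminf f) * x = 0"
    by simp
  then show ?thesis unfolding quasi_invertible_def by blast
qed

lemma scaleC_zero_left: "scaleC 0 x = (0::'a::complex_banach_algebra)"
  using scaleC_of_real[of 0 x] by simp

lemma scaleC_zero_right: "scaleC z 0 = (0::'a::complex_banach_algebra)"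
  using scaleC_add_right[of z 0 "0::'a"] by simp

lemma quasi_invertible_0: "quasi_invertible 0"
  by (rule quasi_invertible_if_norm_less) simp

lemma spectral_radius_eq_0_iff:
  fixes a :: "'a::complex_banach_algebra"
  shows "spectral_radius a = 0 \<longleftrightarrow> (\<forall>z. quasi_invertible (scaleC z a))"
proof
  assume r: "spectral_radius a = 0"
  have bdd: "cmod z \<le> norm a" if "z \<in> spectrum a" for z
  proof (rule ccontr)
    assume z: "\<not> cmod z \<le> norm a"
    then have "z \<noteq> 0" by auto
    have "norm (scaleC (inverse z) a) < 1"
      using z \<open>z \<noteq> 0\<close> unfolding norm_scaleC norm_inverse by (simp add: field_simps)
    then have "quasi_invertible (scaleC (inverse z) a)" by (rule quasi_invertible_if_norm_less)
    then show False using that \<open>z \<noteq> 0\<close> by (simp add: spectrum_def)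
  qed
  then have bdd': "bdd_above (cmod ` spectrum a)" by (intro bdd_aboveI[of _ "norm a"]) auto
  show "\<forall>z. quasi_invertible (scaleC z a)"
  proof
    fix z
    show "quasi_invertible (scaleC z a)"
    proof (rule ccontr)
      assume nq: "\<not> ?thesis"
      then have "z \<noteq> 0" using quasi_invertible_0 by (metis scaleC_zero_left)
      then have "inverse z \<in> spectrum a" using nq by (simp add: spectrum_def)
      then have "cmod (inverse z) \<le> spectral_radius a"
        unfolding spectral_radius_def by (intro cSup_upper[OF _ bdd']) auto
      then show False using r \<open>z \<noteq> 0\<close> by simp
    qed
  qed
next
  assume "\<forall>z. quasi_invertible (scaleC z a)"
  then have "spectrum a = {0}" by (auto simp: spectrum_def)
  then show "spectral_radius a = 0" by (simp add: spectral_radius_def)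
qed

lemma quasi_invertible_add_right_annihilator:
  assumes "quasi_invertible y" and r: "r \<in> right_annihilator"
  shows "quasi_invertible (y + r)"
proof -
  obtain c where c: "y + c - y * c = 0" "y + c - c * y = 0"
    using assms unfolding quasi_invertible_def by blast
  have r0: "a * r = 0" "a * (r * b) = 0" for a b
    using r by (simp_all add: right_annihilator_def flip: mult.assoc)
  define c' where "c' = c + (r * c - r)"
  have "y + r + c' - (y + r) * c' = y + c - y * c"
    by (simp add: c'_def r0 algebra_simps)
  moreover have "y + r + c' - c' * (y + r) = (y + c - c * y) + r * (y + c - c * y)"
    by (simp add: c'_def r0 algebra_simps)
  ultimately show ?thesis using c unfolding quasi_invertible_def by (metis add_0 mult_zero_right)
qed

definition right_unit :: "'a::complex_banach_algebra" where
  "right_unit = (if \<exists>e::'a. (\<forall>a. a * e = a) \<and> (\<forall>a b. e * (a * b) = e * (b * a))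
     then SOME e. (\<forall>a. a * e = a) \<and> (\<forall>a b. e * (a * b) = e * (b * a)) else 0)"

lemma right_unit_cases:
  "(right_unit::'a::complex_banach_algebra) = 0 \<or>
    (\<forall>a::'a. a * right_unit = a) \<and> (\<forall>a b::'a. right_unit * (a * b) = right_unit * (b * a))"
proof (cases "\<exists>e::'a. (\<forall>a. a * e = a) \<and> (\<forall>a b. e * (a * b) = e * (b * a))")
  case True
  then have "right_unit = (SOME e::'a. (\<forall>a. a * e = a) \<and> (\<forall>a b. e * (a * b) = e * (b * a)))"
    unfolding right_unit_def by (rule if_P)
  then show ?thesis using someI_ex[OF True] by simp
qed (simp only: right_unit_def if_False simp_thms)

lemma right_unit_comm: "right_unit * (a * b) = right_unit * (b * a)"
  using right_unit_cases by (metis mult_zero_left)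

lemma right_unit_idem: "right_unit * right_unit = right_unit"
  using right_unit_cases by (metis mult_zero_left)

text \<open>With \<open>e = right_unit\<close>, the corner \<open>e A\<close> is the quotient \<open>A / rann(A)\<close> realised as a subalgebra
  with identity \<open>e\<close>. The fallback value \<open>0\<close> of \<open>right_unit\<close> and the extra summand \<open>\<complex>\<close> make it a
  commutative Banach algebra with \<open>1 \<noteq> 0\<close> for every \<open>A\<close>, as type class instances demand.\<close>
typedef (overloaded) 'a corner = "{p :: 'a::complex_banach_algebra \<times> complex. right_unit * fst p = fst p}"
  by (rule exI[of _ "(0, 0)"]) simp

setup_lifting type_definition_corner

instantiation corner :: (complex_banach_algebra) comm_ring_1
begin
lift_definition zero_corner :: "'a corner" is "(0, 0)" by simp
lift_definition one_corner :: "'a corner" is "(right_unit, 1)" by (simp add: right_unit_idem)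
lift_definition plus_corner :: "'a corner \<Rightarrow> 'a corner \<Rightarrow> 'a corner" is "(+)"
  by (simp add: distrib_left)
lift_definition minus_corner :: "'a corner \<Rightarrow> 'a corner \<Rightarrow> 'a corner" is "(-)"
  by (simp add: right_diff_distrib)
lift_definition uminus_corner :: "'a corner \<Rightarrow> 'a corner" is "uminus" by simp
lift_definition times_corner :: "'a corner \<Rightarrow> 'a corner \<Rightarrow> 'a corner"
  is "\<lambda>p q. (fst p * fst q, snd p * snd q)"
  by (simp flip: mult.assoc)

instance
proof
  fix a b c :: "'a corner"
  show "a * b * c = a * (b * c)" by transfer (simp add: mult.assoc)
  show "a * b = b * a"
  proof transfer
    fix a b :: "'a \<times> complex"
    assume "right_unit * fst a = fst a" "right_unit * fst b = fst b"
    then have "fst a * fst b = fst b * fst a"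
      using right_unit_comm[of "fst a" "fst b"] by (simp flip: mult.assoc)
    then show "(fst a * fst b, snd a * snd b) = (fst b * fst a, snd b * snd a)"
      by (simp add: mult.commute)
  qed
  show "1 * a = a" by transfer (simp add: prod_eq_iff)
  show "a + b + c = a + (b + c)" by transfer (simp add: add.assoc)
  show "a + b = b + a" by transfer (simp add: add.commute)
  show "0 + a = a" by transfer (simp add: prod_eq_iff)
  show "- a + a = 0" by transfer (simp add: prod_eq_iff)
  show "a - b = a + - b" by transfer simp
  show "(a + b) * c = a * c + b * c" by transfer (simp add: distrib_right)
  show "(0::'a corner) \<noteq> 1" by transfer simp
qed
end

instantiation corner :: (complex_banach_algebra) real_normed_algebra
begin
lift_definition scaleR_corner :: "real \<Rightarrow> 'a corner \<Rightarrow> 'a corner" is scaleR by simp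
lift_definition norm_corner :: "'a corner \<Rightarrow> real" is norm .
definition sgn_corner :: "'a corner \<Rightarrow> 'a corner" where "sgn_corner x = scaleR (inverse (norm x)) x"
definition dist_corner :: "'a corner \<Rightarrow> 'a corner \<Rightarrow> real" where "dist_corner x y = norm (x - y)"
definition uniformity_corner :: "('a corner \<times> 'a corner) filter" where
  "uniformity_corner = (INF e\<in>{0 <..}. principal {(x, y). dist x y < e})"
definition open_corner :: "'a corner set \<Rightarrow> bool" where
  "open_corner U = (\<forall>x\<in>U. \<forall>\<^sub>F (x', y) in uniformity. x' = x \<longrightarrow> y \<in> U)"

instance
proof
  fix a b :: "'a corner" and r s :: real
  show "r *\<^sub>R (a + b) = r *\<^sub>R a + r *\<^sub>R b" by transfer (simp add: scaleR_add_right)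
  show "(r + s) *\<^sub>R a = r *\<^sub>R a + s *\<^sub>R a" by transfer (simp add: scaleR_add_left)
  show "r *\<^sub>R s *\<^sub>R a = (r * s) *\<^sub>R a" by transfer simp
  show "1 *\<^sub>R a = a" by transfer simp
  show "r *\<^sub>R a * b = r *\<^sub>R (a * b)" by transfer simp
  show "a * r *\<^sub>R b = r *\<^sub>R (a * b)" by transfer simp
  show "norm a = 0 \<longleftrightarrow> a = 0" by transfer (simp add: prod_eq_iff)
  show "norm (a + b) \<le> norm a + norm b" by transfer (rule norm_triangle_ineq)
  show "norm (r *\<^sub>R a) = \<bar>r\<bar> * norm a" by transfer simp
  show "norm (a * b) \<le> norm a * norm b"
  proof transfer
    fix p q :: "'a \<times> complex"
    have "(norm (fst p * fst q))\<^sup>2 + (norm (snd p * snd q))\<^sup>2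
      \<le> (norm (fst p) * norm (fst q))\<^sup>2 + (norm (snd p) * norm (snd q))\<^sup>2"
      by (intro add_mono power_mono norm_mult_ineq) auto
    also have "\<dots> \<le> ((norm (fst p))\<^sup>2 + (norm (snd p))\<^sup>2) * ((norm (fst q))\<^sup>2 + (norm (snd q))\<^sup>2)"
      by (simp add: algebra_simps power_mult_distrib)
    finally show "norm (fst p * fst q, snd p * snd q) \<le> norm p * norm q"
      by (simp add: norm_prod_def flip: real_sqrt_mult)
  qed
qed (simp_all add: sgn_corner_def dist_corner_def uniformity_corner_def open_corner_def)
end

instance corner :: (complex_banach_algebra) banach
proof
  fix X :: "nat \<Rightarrow> 'a corner"
  assume X: "Cauchy X"
  have dist: "dist x y = dist (Rep_corner x) (Rep_corner y)" for x y :: "'a corner"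
    by (simp add: dist_norm norm_corner.rep_eq minus_corner.rep_eq)
  have "Cauchy (\<lambda>n. Rep_corner (X n))" using X by (simp add: Cauchy_def dist)
  then obtain l where l: "(\<lambda>n. Rep_corner (X n)) \<longlonglongrightarrow> l"
    using Cauchy_convergent_iff convergent_def by blast
  have "(\<lambda>n. right_unit * fst (Rep_corner (X n))) \<longlonglongrightarrow> right_unit * fst l"
    by (intro tendsto_intros l)
  moreover have "right_unit * fst (Rep_corner (X n)) = fst (Rep_corner (X n))" for n
    using Rep_corner[of "X n"] by simp
  ultimately have "(\<lambda>n. fst (Rep_corner (X n))) \<longlonglongrightarrow> right_unit * fst l" by simp
  moreover have "(\<lambda>n. fst (Rep_corner (X n))) \<longlonglongrightarrow> fst l" by (intro tendsto_intros l)
  ultimately have "right_unit * fst l = fst l" by (rule LIMSEQ_unique)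
  then have "Rep_corner (Abs_corner l) = l" by (intro Abs_corner_inverse) simp
  then have "X \<longlonglongrightarrow> Abs_corner l" using l by (simp add: tendsto_iff dist)
  then show "convergent X" by (auto simp: convergent_def)
qed

instantiation corner :: (complex_banach_algebra) complex_banach_algebra
begin
lift_definition scaleC_corner :: "complex \<Rightarrow> 'a corner \<Rightarrow> 'a corner"
  is "\<lambda>c p. (scaleC c (fst p), c * snd p)"
  by (simp flip: scaleC_mult_right)

instance
proof
  fix c c' :: complex and r :: real and x y :: "'a corner"
  show "scaleC (complex_of_real r) x = r *\<^sub>R x"
    by transfer (simp add: prod_eq_iff scaleC_of_real scaleR_conv_of_real)
  show "scaleC c (x + y) = scaleC c x + scaleC c y"
    by transfer (simp add: scaleC_add_right distrib_left)
  show "scaleC (c + c') x = scaleC c x + scaleC c' x"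
    by transfer (simp add: scaleC_add_left distrib_right)
  show "scaleC c (scaleC c' x) = scaleC (c * c') x"
    by transfer (simp add: scaleC_scaleC)
  show "scaleC 1 x = x" by transfer (simp add: scaleC_one)
  show "norm (scaleC c x) = cmod c * norm x"
  proof transfer
    fix c and p :: "'a \<times> complex"
    have "(norm (scaleC c (fst p)))\<^sup>2 + (norm (c * snd p))\<^sup>2
      = (cmod c)\<^sup>2 * ((norm (fst p))\<^sup>2 + (norm (snd p))\<^sup>2)"
      by (simp add: norm_scaleC norm_mult power_mult_distrib algebra_simps)
    then show "norm (scaleC c (fst p), c * snd p) = cmod c * norm p"
      by (simp add: norm_prod_def real_sqrt_mult)
  qed
  show "scaleC c (x * y) = scaleC c x * y"
    by transfer (simp add: scaleC_mult_left)
  show "scaleC c (x * y) = x * scaleC c y"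
    by transfer (simp add: scaleC_mult_right)
qed
end

lemma derivation_range_in_radical:
  fixes d :: "'a::complex_banach_algebra \<Rightarrow> 'a"
  assumes rad_rann: "(jacobson_radical :: 'a set) = right_annihilator"
    and quot_comm: "\<forall>a b :: 'a. a * b - b * a \<in> jacobson_radical"
    and right_id: "\<exists>e :: 'a. \<forall>a. a * e = a"
    and d: "derivation d"
  shows "d a \<in> jacobson_radical"
proof -
  define E :: 'a where "E = right_unit"
  have "\<exists>e::'a. (\<forall>a. a * e = a) \<and> (\<forall>a b. e * (a * b) = e * (b * a))"
    using right_id quot_comm unfolding rad_rann right_annihilator_def
    by (auto simp: right_diff_distrib)
  from someI_ex[OF this] this have E: "a * E = a" for a
    unfolding E_def right_unit_def by simp
  have E': "a * (E * b) = a * b" for a b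
    by (metis E mult.assoc)
  define D :: "'a corner \<Rightarrow> 'a corner" where
    "D p = Abs_corner (E * d (fst (Rep_corner p)), 0)" for p
  have Rep_D: "Rep_corner (D p) = (E * d (fst (Rep_corner p)), 0)" for p
    unfolding D_def by (rule Abs_corner_inverse) (simp add: E' flip: E_def)
  have Rep: "E * fst (Rep_corner p) = fst (Rep_corner p)" for p :: "'a corner"
    using Rep_corner[of p] by (simp add: E_def)
  have dadd: "d (x + y) = d x + d y" and dscale: "d (scaleC c x) = scaleC c (d x)"
    and dmult: "d (x * y) = d x * y + x * d y" for x y c
    using d by (auto simp: derivation_def clinear_map_def)
  have "derivation D"
    unfolding derivation_def clinear_map_def
  proof (intro conjI allI)
    fix p q :: "'a corner" and c
    show "D (p + q) = D p + D q"
      by (simp add: Rep_corner_inject[symmetric] Rep_D plus_corner.rep_eq dadd distrib_left)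
    show "D (scaleC c p) = scaleC c (D p)"
      by (simp add: Rep_corner_inject[symmetric] Rep_D scaleC_corner.rep_eq dscale scaleC_mult_right)
    show "D (p * q) = D p * q + p * D q"
      by (simp add: Rep_corner_inject[symmetric] Rep_D plus_corner.rep_eq times_corner.rep_eq
          dmult distrib_left E' mult.assoc[symmetric] Rep)
         (simp add: mult.assoc E')
  qed
  moreover have "jacobson_radical = {0 :: 'a corner}"
  proof (intro equalityI subsetI)
    fix p :: "'a corner" assume p: "p \<in> jacobson_radical"
    define x z where "x = fst (Rep_corner p)" and "z = snd (Rep_corner p)"
    have "z = 0"
    proof (rule ccontr)
      assume "z \<noteq> 0"
      have "quasi_invertible (scaleC (inverse z) p + 0 * p)"
        using p unfolding jacobson_radical_def by blast
      then obtain c where "scaleC (inverse z) p + c - scaleC (inverse z) p * c = 0"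
        by (auto simp: quasi_invertible_def)
      then have "snd (Rep_corner (scaleC (inverse z) p + c - scaleC (inverse z) p * c)) = 0"
        by (simp add: zero_corner.rep_eq)
      then show False using \<open>z \<noteq> 0\<close>
        by (simp add: plus_corner.rep_eq minus_corner.rep_eq times_corner.rep_eq
            scaleC_corner.rep_eq z_def)
    qed
    have "quasi_invertible (scaleC \<mu> x + b * x)" for b \<mu>
    proof -
      define b' where "b' = Abs_corner (E * b, 0)"
      have b': "Rep_corner b' = (E * b, 0)"
        unfolding b'_def by (rule Abs_corner_inverse) (simp add: E' flip: E_def)
      have "quasi_invertible (scaleC \<mu> p + b' * p)"
        using p unfolding jacobson_radical_def by blast
      then obtain c where c: "scaleC \<mu> p + b' * p + c - (scaleC \<mu> p + b' * p) * c = 0"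
        "scaleC \<mu> p + b' * p + c - c * (scaleC \<mu> p + b' * p) = 0"
        by (auto simp: quasi_invertible_def)
      define c' where "c' = fst (Rep_corner c)"
      have "scaleC \<mu> x + E * b * x + c' - (scaleC \<mu> x + E * b * x) * c' = 0"
        "scaleC \<mu> x + E * b * x + c' - c' * (scaleC \<mu> x + E * b * x) = 0"
        using c[THEN arg_cong[of _ _ "\<lambda>p. fst (Rep_corner p)"]]
        by (simp_all add: plus_corner.rep_eq minus_corner.rep_eq times_corner.rep_eq
            scaleC_corner.rep_eq zero_corner.rep_eq b' x_def c'_def)
      then have "quasi_invertible (scaleC \<mu> x + E * b * x)"
        unfolding quasi_invertible_def by blast
      moreover have "b * x - E * b * x \<in> right_annihilator"
        by (simp add: right_annihilator_def right_diff_distrib mult.assoc E')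
      ultimately have "quasi_invertible (scaleC \<mu> x + E * b * x + (b * x - E * b * x))"
        by (rule quasi_invertible_add_right_annihilator)
      then show ?thesis by simp
    qed
    then have "x \<in> right_annihilator" unfolding rad_rann[symmetric] jacobson_radical_def by blast
    then have "x = 0" using Rep[of p] by (simp add: right_annihilator_def x_def)
    then have "p = 0" using \<open>z = 0\<close>
      by (simp add: Rep_corner_inject[symmetric] zero_corner.rep_eq x_def z_def prod_eq_iff)
    then show "p \<in> {0}" by simp
  next
    fix p :: "'a corner" assume "p \<in> {0}"
    then show "p \<in> jacobson_radical"
      by (simp add: jacobson_radical_def scaleC_zero_right quasi_invertible_0)
  qed
  ultimately have D0: "D p = 0" for p by (rule derivation_semisimple_eq_0)
  have EdE: "E * d (E * b) = 0" for b
  proof -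
    have "Rep_corner (Abs_corner (E * b, 0)) = (E * b, 0 :: complex)"
      by (rule Abs_corner_inverse) (simp add: E' flip: E_def)
    then show ?thesis
      using arg_cong[OF D0[of "Abs_corner (E * b, 0)"], of Rep_corner]
      by (simp add: Rep_D zero_corner.rep_eq)
  qed
  have "E * d a = 0"
    using EdE[of a] EdE[of E] by (simp add: dmult[of E a] distrib_left E E' flip: mult.assoc)
  then have "b * d a = 0" for b using E'[of b "d a"] by simp
  then show ?thesis unfolding rad_rann right_annihilator_def by blast
qed

theorem theorem3p5:
  fixes \<delta> d :: "'a::complex_banach_algebra \<Rightarrow> 'a"
  assumes rad_rann: "(jacobson_radical :: 'a set) = right_annihilator"
    and quot_comm: "\<forall>a b :: 'a. a * b - b * a \<in> jacobson_radical"
    and right_id: "\<exists>e :: 'a. \<forall>a. a * e = a"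
    and gd: "generalized_derivation \<delta> d"
  shows "(range \<delta> \<subseteq> jacobson_radical \<longleftrightarrow> spectrally_infinitesimal \<delta>)
       \<and> (spectrally_infinitesimal \<delta> \<longleftrightarrow> \<delta> = d)"
proof -
  obtain e :: 'a where e: "\<And>a. a * e = a" using right_id by blast
  have d: "derivation d" and \<delta>mult: "\<delta> (a * b) = a * \<delta> b + d a * b" for a b
    using gd by (auto simp: generalized_derivation_def)
  have d_rad: "d a \<in> jacobson_radical" for a
    by (rule derivation_range_in_radical[OF rad_rann quot_comm right_id d])
  have \<delta>: "\<delta> a = a * \<delta> e + d a" for a
    using \<delta>mult[of a e] by (simp add: e)
  have eq: "\<delta> = d" if "\<delta> e \<in> jacobson_radical"
  proof
    fix a
    have "a * \<delta> e = 0" using that unfolding rad_rann right_annihilator_def by blast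
    then show "\<delta> a = d a" by (subst \<delta>) simp
  qed
  have 1: "spectrally_infinitesimal \<delta>" if "range \<delta> \<subseteq> jacobson_radical"
  proof -
    have "quasi_invertible (scaleC z (\<delta> a))" for z a
    proof -
      have "quasi_invertible (scaleC z (\<delta> a) + 0 * \<delta> a)"
        using that unfolding jacobson_radical_def by blast
      then show ?thesis by simp
    qed
    then show ?thesis by (simp add: spectrally_infinitesimal_def spectral_radius_eq_0_iff)
  qed
  have 2: "\<delta> = d" if si: "spectrally_infinitesimal \<delta>"
  proof (rule eq)
    have "quasi_invertible (scaleC \<mu> (\<delta> e) + b * \<delta> e)" for \<mu> b
    proof -
      define c where "c = scaleC \<mu> e + b"
      define r where "r = scaleC \<mu> (\<delta> e) - scaleC \<mu> e * \<delta> e - d c"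
      have "quasi_invertible (scaleC 1 (\<delta> c))"
        using si unfolding spectrally_infinitesimal_def spectral_radius_eq_0_iff by blast
      then have "quasi_invertible (\<delta> c)" by (simp add: scaleC_one)
      moreover have "r \<in> right_annihilator"
      proof -
        have "a * d c = 0" for a using d_rad[of c] unfolding rad_rann right_annihilator_def by blast
        moreover have "a * (scaleC \<mu> e * \<delta> e) = scaleC \<mu> (a * \<delta> e)" for a
          by (metis e mult.assoc scaleC_mult_left scaleC_mult_right)
        ultimately show ?thesis
          by (simp add: right_annihilator_def r_def right_diff_distrib scaleC_mult_right)
      qed
      ultimately have "quasi_invertible (\<delta> c + r)"
        by (rule quasi_invertible_add_right_annihilator)
      moreover have "\<delta> c + r = scaleC \<mu> (\<delta> e) + b * \<delta> e"
        by (subst \<delta>) (simp add: r_def c_def distrib_right)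
      ultimately show ?thesis by simp
    qed
    then show "\<delta> e \<in> jacobson_radical" unfolding jacobson_radical_def by blast
  qed
  have 3: "range \<delta> \<subseteq> jacobson_radical" if "\<delta> = d"
    using that d_rad by auto
  show ?thesis using 1 2 3 by blast
qed

end
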